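(* Let $R$ be a unital commutative ring in which $6$ is invertible and let $n\geq 3$. Then every matrix unit $e_{ij}$ ($1\le i,j\le n$) is a Jordan all-derivable point in $M_n(R)$.
   Context: $M_n(R)$ is the algebra of all $n\times n$ matrices over $R$; $e_{ij}$ denotes the matrix unit with $1$ in position $(i,j)$ and $0$ elsewhere, and $I$ denotes the identity matrix. The Jordan product is $x\circ y=xy+yx$; for an $M_n(R)$-bimodule $X$, $x\in X$ and $S\in M_n(R)$, one writes likewise $x\circ S=S\circ x=xS+Sx\in X$. Bimodules over the $R$-algebra $M_n(R)$ are unital, and the left and right actions of $R$ on them coincide. A matrix $H\in M_n(R)$ is called a Jordan all-derivable point in $M_n(R)$ if for every $M_n(R)$-bimodule $X$, every $R$-linear map $\varphi:M_n(R)\to X$ with $\varphi(I)=0$ which is Jordan derivable at $H$, i.e. satisfies $\varphi(S\circ T)=\varphi(S)\circ T+S\circ\varphi(T)$ for all $S,T\in M_n(R)$ with $S\circ T=H$, is a Jordan derivation, i.e. satisfies $\varphi(S\circ T)=\varphi(S)\circ T+S\circ\varphi(T)$ for all $S,T\in M_n(R)$. *)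

theory Defs
  imports "HOL-Analysis.Analysis"
begin

text \<open>\<open>M_n(R)\<close> is the type \<open>'r^'n^'n\<close> with \<open>n = CARD('n)\<close>. The matrix product is
  \<open>**\<close>; the identity is \<open>mat 1\<close>.\<close>

definition smult_matrix :: "'r::comm_ring_1 \<Rightarrow> 'r^'n^'n \<Rightarrow> 'r^'n^'n::finite"
  where "smult_matrix r S = (\<chi> i j. r * S $ i $ j)"

lemma module_smult_matrix: "module smult_matrix"
  by unfold_locales (simp_all add: smult_matrix_def vec_eq_iff algebra_simps)

definition matrix_unit :: "'n \<Rightarrow> 'n \<Rightarrow> 'r::comm_ring_1^'n^'n::finite"
  where "matrix_unit i j = (\<chi> k l. if k = i \<and> l = j then 1 else 0)"

definition matrix_jordan :: "'r::comm_ring_1^'n^'n \<Rightarrow> 'r^'n^'n \<Rightarrow> 'r^'n^'n::finite"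
  where "matrix_jordan S T = S ** T + T ** S"

text \<open>Unital bimodules over the \<open>R\<close>-algebra \<open>M_n(R)\<close>, with left action \<open>lact S x = Sx\<close> and right
  action \<open>ract x S = xS\<close>. The last two axioms say that acting by \<open>r \<cdot> I\<close> from either side
  is the scalar action of \<open>r\<close>; with the other axioms this gives the \<open>R\<close>-bilinearity of both
  actions.\<close>

locale matrix_bimodule = module scale
  for scale :: "'r::comm_ring_1 \<Rightarrow> 'x::ab_group_add \<Rightarrow> 'x"
    and lact :: "'r^'n^'n::finite \<Rightarrow> 'x \<Rightarrow> 'x"
    and ract :: "'x \<Rightarrow> 'r^'n^'n \<Rightarrow> 'x" +
  assumes lact_add_left: "lact (S + T) x = lact S x + lact T x"
    and lact_add_right: "lact S (x + y) = lact S x + lact S y"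
    and lact_mult: "lact (S ** T) x = lact S (lact T x)"
    and lact_one: "lact (mat 1) x = x"
    and ract_add_left: "ract (x + y) S = ract x S + ract y S"
    and ract_add_right: "ract x (S + T) = ract x S + ract x T"
    and ract_mult: "ract x (S ** T) = ract (ract x S) T"
    and ract_one: "ract x (mat 1) = x"
    and lact_ract: "ract (lact S x) T = lact S (ract x T)"
    and lact_scalar: "lact (mat r) x = scale r x"
    and ract_scalar: "ract x (mat r) = scale r x"

definition bimodule_jordan ::
    "('r::comm_ring_1^'n^'n::finite \<Rightarrow> 'x::ab_group_add \<Rightarrow> 'x) \<Rightarrow> ('x \<Rightarrow> 'r^'n^'n \<Rightarrow> 'x)
      \<Rightarrow> 'x \<Rightarrow> 'r^'n^'n \<Rightarrow> 'x"
  where "bimodule_jordan lact ract x S = ract x S + lact S x"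

definition jordan_derivable_at ::
    "('r::comm_ring_1^'n^'n::finite \<Rightarrow> 'x::ab_group_add \<Rightarrow> 'x) \<Rightarrow> ('x \<Rightarrow> 'r^'n^'n \<Rightarrow> 'x)
      \<Rightarrow> ('r^'n^'n \<Rightarrow> 'x) \<Rightarrow> 'r^'n^'n \<Rightarrow> bool"
  where "jordan_derivable_at lact ract \<phi> H \<longleftrightarrow>
    (\<forall>S T. matrix_jordan S T = H \<longrightarrow>
      \<phi> (matrix_jordan S T) = bimodule_jordan lact ract (\<phi> S) T + bimodule_jordan lact ract (\<phi> T) S)"

definition jordan_derivation ::
    "('r::comm_ring_1^'n^'n::finite \<Rightarrow> 'x::ab_group_add \<Rightarrow> 'x) \<Rightarrow> ('x \<Rightarrow> 'r^'n^'n \<Rightarrow> 'x)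
      \<Rightarrow> ('r^'n^'n \<Rightarrow> 'x) \<Rightarrow> bool"
  where "jordan_derivation lact ract \<phi> \<longleftrightarrow>
    (\<forall>S T. \<phi> (matrix_jordan S T) =
      bimodule_jordan lact ract (\<phi> S) T + bimodule_jordan lact ract (\<phi> T) S)"

text \<open>A definition cannot quantify over types, so the carrier type \<open>'x\<close> of the bimodules is passed
  as an argument of type \<open>'x itself\<close>. A statement in which \<open>'x\<close> is a free type variable
  speaks about all bimodules.\<close>

definition jordan_all_derivable_point ::
    "'x::ab_group_add itself \<Rightarrow> 'r::comm_ring_1^'n^'n::finite \<Rightarrow> bool"
  where "jordan_all_derivable_point X H \<longleftrightarrow>
    (\<forall>(scale :: 'r \<Rightarrow> 'x \<Rightarrow> 'x) (lact :: 'r^'n^'n \<Rightarrow> 'x \<Rightarrow> 'x) (ract :: 'x \<Rightarrow> 'r^'n^'n \<Rightarrow> 'x)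
        (\<phi> :: 'r^'n^'n \<Rightarrow> 'x).
      matrix_bimodule scale lact ract \<longrightarrow> module_hom smult_matrix scale \<phi> \<longrightarrow>
      \<phi> (mat 1) = 0 \<longrightarrow> jordan_derivable_at lact ract \<phi> H \<longrightarrow> jordan_derivation lact ract \<phi>)"

end

theory Submission
  imports Defs
begin

text \<open>The defect \<open>\<delta> S T = \<phi> (S \<circ> T) - \<phi> S \<circ> T - S \<circ> \<phi> T\<close> is a symmetric bilinear map
  with \<open>\<delta> I T = 0\<close>, and it vanishes whenever \<open>S \<circ> T\<close> is a unit multiple of \<open>H\<close>; the bimodule
  plays no further role. If some \<open>T\<^sub>0\<close> solves \<open>S \<circ> T\<^sub>0 = r H\<close> with \<open>r\<close> a unit, then \<open>T\<^sub>0\<close> and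
  \<open>T\<^sub>0 + T\<close> are both solutions for every \<open>T\<close> with \<open>S \<circ> T = 0\<close>, so \<open>\<delta> S T = 0\<close> for such \<open>T\<close>.
  Taking \<open>S\<close> diagonal, or diagonal plus one matrix unit, this gives \<open>\<delta> = 0\<close> on nearly all pairs of
  matrix units. The remaining pairs are coupled, and need an \<open>S\<close> with eigenvalues 1 and 2, for
  which \<open>S \<circ> T = H\<close> is solvable because 2, 3 and 4 are units.\<close>

section \<open>Arithmetic of matrix units\<close>

notation smult_matrix (infixr "*\<^sub>M" 75)
notation matrix_unit ("E")

interpretation mat: module smult_matrix by (rule module_smult_matrix)

lemma matrix_unit_mult:
  "(E a b :: 'r::comm_ring_1^'n^'n::finite) ** E c d = (if b = c then E a d else 0)"
proof -
  have "(\<Sum>x\<in>UNIV. E a b $ k $ x * E c d $ x $ l)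
      = (\<Sum>x\<in>UNIV. if x = b then if k = a \<and> b = c \<and> l = d then 1 else 0 else 0 :: 'r)" for k l
    by (rule sum.cong) (auto simp: matrix_unit_def)
  then show ?thesis
    by (simp add: matrix_matrix_mult_def vec_eq_iff) (simp add: matrix_unit_def)
qed

lemma smult_matrix_mult_left:
  "(r *\<^sub>M A) ** B = r *\<^sub>M (A ** (B :: 'r::comm_ring_1^'n^'n::finite))"
  by (simp add: matrix_matrix_mult_def smult_matrix_def vec_eq_iff sum_distrib_left algebra_simps)

lemma smult_matrix_mult_right:
  "A ** (r *\<^sub>M B) = r *\<^sub>M (A ** (B :: 'r::comm_ring_1^'n^'n::finite))"
  by (simp add: matrix_matrix_mult_def smult_matrix_def vec_eq_iff sum_distrib_left algebra_simps)

lemma smult_matrix_component: "(r *\<^sub>M A) $ k $ l = r * A $ k $ l"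
  by (simp add: smult_matrix_def)

lemma matrix_add_mult:
  "(A + B) ** C = A ** C + B ** (C :: 'r::comm_ring_1^'n^'n::finite)"
  by (simp add: matrix_matrix_mult_def vec_eq_iff sum.distrib algebra_simps)

lemma matrix_diff_mult:
  "(A - B) ** C = A ** C - B ** (C :: 'r::comm_ring_1^'n^'n::finite)"
  by (simp add: matrix_matrix_mult_def vec_eq_iff sum_subtractf algebra_simps)

lemma matrix_mult_diff:
  "A ** (B - C) = A ** B - A ** (C :: 'r::comm_ring_1^'n^'n::finite)"
  by (simp add: matrix_matrix_mult_def vec_eq_iff sum_subtractf algebra_simps)

lemmas jordan_expand = matrix_jordan_def matrix_unit_mult smult_matrix_mult_left smult_matrix_mult_right
  matrix_diff_mult matrix_mult_diff matrix_add_mult matrix_add_ldistrib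

section \<open>Symmetric bilinear defects vanishing at H\<close>

locale jordan_defect =
  module scale for scale :: "'r::comm_ring_1 \<Rightarrow> 'x::ab_group_add \<Rightarrow> 'x" +
  fixes \<delta> :: "'r^'n^'n::finite \<Rightarrow> 'r^'n^'n \<Rightarrow> 'x" and H :: "'r^'n^'n"
  assumes six_unit: "(6 :: 'r) dvd 1"
    and add_left: "\<delta> (S + S') T = \<delta> S T + \<delta> S' T"
    and smult_left: "\<delta> (r *\<^sub>M S) T = scale r (\<delta> S T)"
    and commute: "\<delta> S T = \<delta> T S"
    and one_left: "\<delta> (mat 1) T = 0"
    and zero_at: "matrix_jordan S T = H \<Longrightarrow> \<delta> S T = 0"
begin

lemma add_right: "\<delta> S (T + T') = \<delta> S T + \<delta> S T'"
  by (metis add_left commute)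

lemma smult_right: "\<delta> S (r *\<^sub>M T) = scale r (\<delta> S T)"
  by (metis smult_left commute)

lemma diff_left: "\<delta> (S - S') T = \<delta> S T - \<delta> S' T"
  using add_left[of "S - S'" S' T] by (simp add: algebra_simps)

lemma diff_right: "\<delta> S (T - T') = \<delta> S T - \<delta> S T'"
  by (metis diff_left commute)

lemma zero_left: "\<delta> 0 T = 0"
  using diff_left[of 0 0 T] by simp

lemma sum_left: "\<delta> (sum f A) T = (\<Sum>a\<in>A. \<delta> (f a) T)"
  by (induction A rule: infinite_finite_induct) (simp_all add: zero_left add_left)

lemmas expand = add_left add_right smult_left smult_right one_left
  diff_left diff_right

lemma units: "(2 :: 'r) dvd 1" "(3 :: 'r) dvd 1" "(4 :: 'r) dvd 1" "(12 :: 'r) dvd 1"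
proof -
  have "(2 :: 'r) dvd 6" "(3 :: 'r) dvd 6"
    using dvd_triv_left[of "2 :: 'r" 3] dvd_triv_left[of "3 :: 'r" 2] by simp_all
  then show two: "(2 :: 'r) dvd 1" and "(3 :: 'r) dvd 1"
    using six_unit dvd_trans by blast+
  show "(4 :: 'r) dvd 1" "(12 :: 'r) dvd 1"
    using mult_dvd_mono[OF two two] mult_dvd_mono[OF two six_unit] by simp_all
qed

lemma scale_unit_eq_0_iff: "r dvd 1 \<Longrightarrow> scale r x = 0 \<longleftrightarrow> x = 0"
proof
  assume "r dvd 1" "scale r x = 0"
  then obtain q where "1 = q * r" by (metis dvdE mult.commute)
  then have "x = scale q (scale r x)" by (metis scale_one scale_scale)
  then show "x = 0" using \<open>scale r x = 0\<close> by simp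
qed simp

text \<open>Dividing T by the unit r gives a solution for H itself. This keeps the explicit
  witnesses below free of fractions.\<close>

lemma zero_at_multiple:
  assumes "matrix_jordan S T = r *\<^sub>M H" "r dvd 1"
  shows "\<delta> S T = 0"
proof -
  obtain q where q: "1 = r * q" using assms(2) by (rule dvdE)
  have "matrix_jordan S (q *\<^sub>M T) = q *\<^sub>M matrix_jordan S T"
    by (simp add: jordan_expand mat.scale_right_distrib)
  also have "\<dots> = H" using assms(1) q by (simp add: mult.commute)
  finally have "scale q (\<delta> S T) = 0" using zero_at[of S "q *\<^sub>M T"] by (simp add: smult_right)
  then show ?thesis using q scale_unit_eq_0_iff[of q] dvd_triv_right[of q r] by simp
qed

lemma zero_at_zero:
  assumes "matrix_jordan S T\<^sub>0 = r *\<^sub>M H" "r dvd 1" "matrix_jordan S T = 0"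
  shows "\<delta> S T = 0"
proof -
  have "matrix_jordan S (T\<^sub>0 + T) = r *\<^sub>M H"
    using assms(1,3) by (simp add: matrix_jordan_def matrix_add_mult matrix_add_ldistrib algebra_simps)
  then show ?thesis using zero_at_multiple assms(1,2) by (metis add_0 add_right)
qed


lemmas compute = jordan_expand vec_eq_iff smult_matrix_component units six_unit

lemma vanishes:
  assumes "\<And>a b c d. \<delta> (E a b) (E c d) = 0"
  shows "\<delta> S T = 0"
proof -
  have decompose: "A = (\<Sum>a\<in>UNIV. \<Sum>b\<in>UNIV. A $ a $ b *\<^sub>M E a b)" for A :: "'r^'n^'n"
  proof -
    have "(\<Sum>b\<in>UNIV. A $ a $ b * E a b $ k $ l) = (if a = k then A $ a $ l else 0)" for a k l
      by (cases "a = k") (simp_all add: matrix_unit_def if_distrib cong: if_cong)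
    then show ?thesis
      by (simp add: vec_eq_iff smult_matrix_component)
  qed
  have "\<delta> (E a b) T = 0" for a b T
  proof -
    have "\<delta> T (E a b) = (\<Sum>c\<in>UNIV. \<Sum>d\<in>UNIV. scale (T $ c $ d) (\<delta> (E c d) (E a b)))"
      by (subst decompose) (simp only: sum_left smult_left)
    then show ?thesis by (simp add: assms commute[of "E a b" T])
  qed
  moreover have "\<delta> S T = (\<Sum>c\<in>UNIV. \<Sum>d\<in>UNIV. scale (S $ c $ d) (\<delta> (E c d) T))"
    by (subst decompose) (simp only: sum_left smult_left)
  ultimately show ?thesis by simp
qed

end

section \<open>Diagonal matrix units, H = e_ii\<close>

locale diagonal_defect = jordan_defect scale \<delta> "E i i"
  for scale :: "'r::comm_ring_1 \<Rightarrow> 'x::ab_group_add \<Rightarrow> 'x"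
    and \<delta> :: "'r^'n^'n::finite \<Rightarrow> 'r^'n^'n \<Rightarrow> 'x" and i :: 'n
begin

text \<open>For diagonal S with entries s_m, S o e_kl = (s_k + s_l) e_kl and S o e_ii = 2 s_i e_ii.
  Apart from the direct case of e_ii with itself, every S below has s_k + s_l = 0 and s_i = 1 or
  -1.\<close>

lemma diag: "\<delta> (E m m) (E k l) = 0"
proof -
  have endpoint: "\<delta> (E x x) (E k l) = 0" if "k \<noteq> l" "x = k \<or> x = l" for x k l
  proof -
    have "\<delta> (mat 1 - 2 *\<^sub>M E x x) (E k l) = 0"
      by (rule zero_at_zero[where T\<^sub>0 = "E i i" and r = "if x = i then - 2 else 2"])
        (use that in \<open>auto simp: compute\<close>)
    then show ?thesis by (simp add: expand scale_unit_eq_0_iff units)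
  qed
  have i: "\<delta> (E i i) (E k l) = 0" for k l
  proof -
    have "\<delta> (E i i) (E k l) = 0" if "i \<noteq> k" "i \<noteq> l"
      by (rule zero_at_zero[where T\<^sub>0 = "E i i" and r = 2]) (use that in \<open>auto simp: compute\<close>)
    moreover have "\<delta> (E i i) (E i i) = 0"
      by (rule zero_at_multiple[where r = 2]) (auto simp: compute)
    ultimately show ?thesis using endpoint by metis
  qed
  show ?thesis
  proof (cases "m = i \<or> k \<noteq> l \<and> (m = k \<or> m = l)")
    case True
    then show ?thesis using i endpoint by metis
  next
    case False
    then consider "m \<noteq> i" "m = k" "k = l" | "m \<noteq> i" "m \<noteq> k" "k = i" "l = i"
      | "m \<noteq> i" "m \<noteq> k" "k = l" "k \<noteq> i" | "m \<noteq> i" "m \<noteq> k" "m \<noteq> l" "k \<noteq> l" by metis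
    then show ?thesis
    proof cases
      case 1
      have "\<delta> (mat 1 - E m m) (E k l) = 0"
        by (rule zero_at_zero[where T\<^sub>0 = "E i i" and r = 2]) (use 1 in \<open>auto simp: compute\<close>)
      then show ?thesis by (simp add: expand)
    next
      case 2
      then show ?thesis using i commute by metis
    next
      case 3
      have "\<delta> (E m m + E i i) (E k l) = 0"
        by (rule zero_at_zero[where T\<^sub>0 = "E i i" and r = 2]) (use 3 in \<open>auto simp: compute\<close>)
      then show ?thesis by (simp add: expand i)
    next
      case 4
      have "\<delta> (mat 1 - 2 *\<^sub>M E k k + E m m) (E k l) = 0"
        by (rule zero_at_zero[where T\<^sub>0 = "E i i" and r = "if k = i then - 2 else 2"])
          (use 4 in \<open>auto simp: compute\<close>)
      then show ?thesis using endpoint[of k l k] 4 by (simp add: expand)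
    qed
  qed
qed

lemma diag': "\<delta> (E k l) (E m m) = 0"
  by (subst commute) (rule diag)

text \<open>Since k and l differ from i, e_kl o e_ii = 0. Hence e_kl can be added to a diagonal S
  without changing S o e_ii.\<close>

lemma off_diag_avoiding:
  assumes "k \<noteq> l" "k \<noteq> i" "l \<noteq> i" "p \<noteq> q"
  shows "\<delta> (E k l) (E p q) = 0"
proof -
  have disjoint: "\<delta> (E k l) (E p q) = 0" if "l \<noteq> p" "k \<noteq> q" "p \<noteq> q" for p q
  proof -
    have "\<delta> (E k l + mat 1 - 2 *\<^sub>M E p p) (E p q) = 0"
      by (rule zero_at_zero[where T\<^sub>0 = "E i i" and r = "if p = i then - 2 else 2"])
        (use that assms in \<open>auto simp: compute\<close>)
    then show ?thesis by (simp add: expand diag)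
  qed
  consider "l \<noteq> p" "k \<noteq> q" | "l = p" "k \<noteq> q" | "l \<noteq> p" "k = q" | "l = p" "k = q" by blast
  then show ?thesis
  proof cases
    case 1
    then show ?thesis using disjoint assms by blast
  next
    case 2
    \<comment> \<open>Here e_kl o e_pq = e_kq. The diagonal part of S kills e_pq and sends e_kq to
      its negative, so the summand \<open>E k q\<close> cancels this product.\<close>
    have "\<delta> (E k l + mat 1 - 2 *\<^sub>M E q q - E k k) (E p q + E k q) = 0"
      by (rule zero_at_zero[where T\<^sub>0 = "E i i" and r = "if q = i then - 2 else 2"])
        (use 2 assms in \<open>auto simp: compute\<close>)
    then show ?thesis using disjoint[of k q] 2 assms by (simp add: expand diag)
  next
    case 3
    have "\<delta> (E k l + mat 1 - 2 *\<^sub>M E p p - E l l) (E p q + E p l) = 0"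
      by (rule zero_at_zero[where T\<^sub>0 = "E i i" and r = "if p = i then - 2 else 2"])
        (use 3 assms in \<open>auto simp: compute\<close>)
    then show ?thesis using disjoint[of p l] 3 assms by (simp add: expand diag)
  next
    case 4
    \<comment> \<open>On the block of k and l both arguments are traceless. Traceless 2 by 2
      matrices satisfy S o T = tr(ST) I by Cayley-Hamilton, and this trace is 0.\<close>
    have "\<delta> (E k l + mat 1 - 2 *\<^sub>M E l l) (2 *\<^sub>M E l k - E k k + E l l) = 0"
      by (rule zero_at_zero[where T\<^sub>0 = "E i i" and r = 2])
        (use 4 assms in \<open>auto simp: compute\<close>)
    then show ?thesis using 4 by (simp add: expand diag diag' scale_unit_eq_0_iff units)
  qed
qed

lemma row_row:
  assumes "k \<noteq> i" "l \<noteq> i"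
  shows "\<delta> (E i k) (E i l) = 0"
proof (cases "k = l")
  case True
  have "\<delta> (E i i + E i k) (E i i - E i k) = 0"
    by (rule zero_at_multiple[where r = 2]) (use assms in \<open>auto simp: compute\<close>)
  then show ?thesis using True by (simp add: expand diag diag')
next
  case False
  \<comment> \<open>Now e_ik o e_ii = e_ik, so \<open>E i i\<close> alone is no solution; the
    summand \<open>- E i k\<close> of \<open>T\<^sub>0\<close> cancels the extra term.\<close>
  have "\<delta> (E i k + mat 1 - 2 *\<^sub>M E l l) (E i l) = 0"
    by (rule zero_at_zero[where T\<^sub>0 = "2 *\<^sub>M E i i - E i k" and r = 4])
      (use False assms in \<open>auto simp: compute\<close>)
  then show ?thesis by (simp add: expand diag)
qed

text \<open>Transposition preserves the Jordan product, fixes e_ii and carries the witnesses of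
  \<open>row_row\<close> to those used here.\<close>

lemma column_column:
  assumes "k \<noteq> i" "l \<noteq> i"
  shows "\<delta> (E k i) (E l i) = 0"
proof (cases "k = l")
  case True
  have "\<delta> (E i i + E k i) (E i i - E k i) = 0"
    by (rule zero_at_multiple[where r = 2]) (use assms in \<open>auto simp: compute\<close>)
  then show ?thesis using True by (simp add: expand diag diag')
next
  case False
  have "\<delta> (E k i + mat 1 - 2 *\<^sub>M E l l) (E l i) = 0"
    by (rule zero_at_zero[where T\<^sub>0 = "2 *\<^sub>M E i i - E k i" and r = 4])
      (use False assms in \<open>auto simp: compute\<close>)
  then show ?thesis by (simp add: expand diag)
qed

lemma row_column:
  assumes "k \<noteq> i" "l \<noteq> i"
  shows "\<delta> (E i k) (E l i) = 0"
proof (cases "k = l")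
  case True
  \<comment> \<open>The left argument has trace 3 and determinant 2 on the block of \<open>i\<close> and \<open>k\<close>.\<close>
  have "\<delta> (E k i - 2 *\<^sub>M E i k + 3 *\<^sub>M E k k)
      (11 *\<^sub>M E i i + 6 *\<^sub>M E i k - 3 *\<^sub>M E k i - 2 *\<^sub>M E k k) = 0"
    by (rule zero_at_multiple[where r = 12]) (use assms in \<open>auto simp: compute\<close>)
  \<comment> \<open>The two cross terms contribute 1 * 6 and (-2) * (-3); the squares vanish by
    \<open>row_row\<close> and \<open>column_column\<close>.\<close>
  then have "scale 12 (\<delta> (E i k) (E l i)) = 0"
    using row_row[OF assms(1) assms(1)] column_column[OF assms(1) assms(1)] True
    by (simp add: expand diag diag' commute[of "E l i" "E i l"]
        eq_neg_iff_add_eq_0 flip: scale_left_distrib)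
  then show ?thesis by (simp add: scale_unit_eq_0_iff units)
next
  case False
  \<comment> \<open>The diagonal entries of S at l and k are -1 and 2, so \<open>- E l k\<close>
    contributes -e_lk and cancels e_ik o e_li = e_lk.\<close>
  have "\<delta> (E i k + mat 1 - 2 *\<^sub>M E l l + E k k) (E l i - E l k) = 0"
    by (rule zero_at_zero[where T\<^sub>0 = "3 *\<^sub>M E i i - E i k" and r = 6])
      (use False assms in \<open>auto simp: compute\<close>)
  moreover have "\<delta> (E i k) (E l k) = 0"
    using off_diag_avoiding[of l k i k] False assms by (metis commute)
  ultimately show ?thesis by (simp add: expand diag)
qed

lemma units_vanish: "\<delta> (E a b) (E c d) = 0"
proof -
  consider "a = b \<or> c = d" | "a \<noteq> b" "c \<noteq> d" "a \<noteq> i \<and> b \<noteq> i \<or> c \<noteq> i \<and> d \<noteq> i"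
    | "a \<noteq> b" "c \<noteq> d" "a = i \<or> b = i" "c = i \<or> d = i" by blast
  then show ?thesis
  proof cases
    case 1
    then show ?thesis using diag diag' by blast
  next
    case 2
    then show ?thesis
      using off_diag_avoiding[of a b c d] off_diag_avoiding[of c d a b] commute[of "E a b" "E c d"] by auto
  next
    case 3
    then show ?thesis
      using row_row[of b d] row_column[of b c] column_column[of a c] row_column[of d a]
        commute[of "E a b" "E c d"] by auto
  qed
qed

end

section \<open>Off-diagonal matrix units, H = e_ij\<close>

locale off_diagonal_defect = jordan_defect scale \<delta> "E i j"
  for scale :: "'r::comm_ring_1 \<Rightarrow> 'x::ab_group_add \<Rightarrow> 'x"
    and \<delta> :: "'r^'n^'n::finite \<Rightarrow> 'r^'n^'n \<Rightarrow> 'x" and i j :: 'n +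
  assumes i_neq_j: "i \<noteq> j"
begin

text \<open>For diagonal S, S o e_ij = (s_i + s_j) e_ij. Up to swapping the arguments, each S below
  makes this sum 1 or 2 and has entry 0 where the other argument is supported.\<close>

lemma diag_diag: "\<delta> (E m m) (E k k) = 0"
proof -
  consider "m = k" | "m \<noteq> k" "m = i \<or> m = j" | "m \<noteq> k" "k = i \<or> k = j"
    | "m \<noteq> k" "m \<noteq> i" "m \<noteq> j" "k \<noteq> i" "k \<noteq> j" by blast
  then show ?thesis
  proof cases
    case 1
    have "\<delta> (mat 1 - E m m) (E k k) = 0"
      by (rule zero_at_zero[where T\<^sub>0 = "E i j" and r = "if m = i \<or> m = j then 1 else 2"])
        (use 1 i_neq_j in \<open>auto simp: compute\<close>)
    then show ?thesis by (simp add: expand)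
  next
    case 2
    show ?thesis
      by (rule zero_at_zero[where T\<^sub>0 = "E i j" and r = 1]) (use 2 i_neq_j in \<open>auto simp: compute\<close>)
  next
    case 3
    show ?thesis
      by (subst commute, rule zero_at_zero[where T\<^sub>0 = "E i j" and r = 1])
        (use 3 i_neq_j in \<open>auto simp: compute\<close>)
  next
    case 4
    have "\<delta> (E m m + E i i) (E k k) = 0"
      by (rule zero_at_zero[where T\<^sub>0 = "E i j" and r = 1]) (use 4 i_neq_j in \<open>auto simp: compute\<close>)
    moreover have "\<delta> (E i i) (E k k) = 0"
      by (rule zero_at_zero[where T\<^sub>0 = "E i j" and r = 1]) (use 4 i_neq_j in \<open>auto simp: compute\<close>)
    ultimately show ?thesis by (simp add: expand)
  qed
qed

text \<open>The pair (j, i) is left to \<open>opposite_block\<close> and \<open>opposite\<close>: a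
  diagonal S kills e_ji exactly when it kills e_ij, so diagonal choices of S cannot reach
  it.\<close>

lemma diag_off_diag:
  assumes "k \<noteq> l" "k \<noteq> j \<or> l \<noteq> i"
  shows "\<delta> (E m m) (E k l) = 0"
proof (cases "k = i \<and> l = j")
  case True
  consider "m = i \<or> m = j" | "m \<noteq> i" "m \<noteq> j" by blast
  then show ?thesis
  proof cases
    case 1
    show ?thesis
      by (rule zero_at_multiple[where r = 1]) (use 1 True i_neq_j in \<open>auto simp: compute\<close>)
  next
    case 2
    have "\<delta> (mat 1 + E m m) (E k l) = 0"
      by (rule zero_at_multiple[where r = 2]) (use 2 True i_neq_j in \<open>auto simp: compute\<close>)
    then show ?thesis by (simp add: expand)
  qed
next
  case False
  have sum: "\<delta> (mat 1 - E k k - E l l) (E k l) = 0"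
    by (rule zero_at_zero[where T\<^sub>0 = "E i j"
          and r = "if k = i \<or> k = j \<or> l = i \<or> l = j then 1 else 2"])
      (use False assms i_neq_j in \<open>auto simp: compute\<close>)
  have one: "\<delta> (mat 1 - 2 *\<^sub>M E x x) (E k l) = 0" if "x = k \<or> x = l" "x \<noteq> i" "x \<noteq> j" for x
    by (rule zero_at_zero[where T\<^sub>0 = "E i j" and r = 2])
      (use that assms i_neq_j in \<open>auto simp: compute\<close>)
  have "- \<delta> (E k k) (E k l) = \<delta> (E l l) (E k l)"
    using sum by (simp add: expand)
  \<comment> \<open>At least one of k and l lies outside {i, j}, so \<open>one\<close> applies to
    it.\<close>
  moreover have "\<delta> (E k k) (E k l) = 0 \<or> \<delta> (E l l) (E k l) = 0"
    using one[of k] one[of l] False assms by (auto simp: expand scale_unit_eq_0_iff units)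
  ultimately have kl: "\<delta> (E k k) (E k l) = 0 \<and> \<delta> (E l l) (E k l) = 0"
    by force
  show ?thesis
  proof (cases "m = k \<or> m = l")
    case True
    then show ?thesis using kl by blast
  next
    case m: False
    have "\<delta> (mat 1 - E k k - E l l + E m m) (E k l) = 0"
      by (rule zero_at_zero[where T\<^sub>0 = "E i j"
            and r = "(if k = i \<or> k = j \<or> l = i \<or> l = j then 1 else 2) + (if m = i \<or> m = j then 1 else 0)"])
        (use False m assms i_neq_j in \<open>auto simp: compute\<close>)
    then show ?thesis using kl by (simp add: expand)
  qed
qed

lemma diag: "k \<noteq> j \<or> l \<noteq> i \<Longrightarrow> \<delta> (E m m) (E k l) = 0"
  using diag_diag diag_off_diag by metis

lemma diag': "k \<noteq> j \<or> l \<noteq> i \<Longrightarrow> \<delta> (E k l) (E m m) = 0"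
  by (subst commute) (rule diag)

text \<open>The conditions on k and l say that e_kl o e_ij = 0, so e_kl can be added to S without
  changing S o e_ij.\<close>

lemma off_diag_avoiding:
  assumes "k \<noteq> l" "k \<noteq> j" "l \<noteq> i" "p \<noteq> q" "p \<noteq> j \<or> q \<noteq> i"
  shows "\<delta> (E k l) (E p q) = 0"
proof -
  have disjoint: "\<delta> (E k l) (E p q) = 0" if "l \<noteq> p" "k \<noteq> q" "p \<noteq> q" "p \<noteq> j \<or> q \<noteq> i" for p q
  proof (cases "p = i \<and> q = j")
    case True
    have "\<delta> (E k l + mat 1) (E p q) = 0"
      by (rule zero_at_multiple[where r = 2]) (use True that assms i_neq_j in \<open>auto simp: compute\<close>)
    then show ?thesis by (simp add: expand)
  next
    case False
    have "\<delta> (E k l + mat 1 - E p p - E q q) (E p q) = 0"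
      by (rule zero_at_zero[where T\<^sub>0 = "E i j"
            and r = "if p = i \<or> p = j \<or> q = i \<or> q = j then 1 else 2"])
        (use False that assms i_neq_j in \<open>auto simp: compute\<close>)
    then show ?thesis using that by (simp add: expand diag)
  qed
  consider "l \<noteq> p" "k \<noteq> q" | "l = p" "k \<noteq> q" | "l \<noteq> p" "k = q" | "l = p" "k = q" by blast
  then show ?thesis
  proof cases
    case 1
    then show ?thesis using disjoint assms by blast
  next
    case 2
    have "\<delta> (E k l + mat 1 - E p p - E q q) (E p q - E k q) = 0"
      by (rule zero_at_zero[where T\<^sub>0 = "E i j"
            and r = "if p = i \<or> p = j \<or> q = i \<or> q = j then 1 else 2"])
        (use 2 assms i_neq_j in \<open>auto simp: compute\<close>)
    then show ?thesis using disjoint[of k q] 2 assms by (simp add: expand diag)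
  next
    case 3
    have "\<delta> (E k l + mat 1 - E p p - E q q) (E p q - E p l) = 0"
      by (rule zero_at_zero[where T\<^sub>0 = "E i j"
            and r = "if p = i \<or> p = j \<or> q = i \<or> q = j then 1 else 2"])
        (use 3 assms i_neq_j in \<open>auto simp: compute\<close>)
    then show ?thesis using disjoint[of p l] 3 assms by (simp add: expand diag)
  next
    case 4
    \<comment> \<open>The block of k and l is again an anticommuting traceless pair. The entry 2
      outside it keeps s_i + s_j a unit; entry 1 would give 0 when l = j.\<close>
    have "\<delta> (E k l + 2 *\<^sub>M mat 1 - E k k - 3 *\<^sub>M E l l) (2 *\<^sub>M E l k - E k k + E l l) = 0"
      by (rule zero_at_zero[where T\<^sub>0 = "E i j" and r = "if k = i then 3 else if l = j then 1 else 4"])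
        (use 4 assms i_neq_j in \<open>auto simp: compute\<close>)
    then show ?thesis using 4 assms by (simp add: expand diag diag' scale_unit_eq_0_iff units)
  qed
qed

text \<open>Since e_jl o e_ij = e_il, each \<open>T\<^sub>0\<close> includes a multiple of e_il that
  cancels this term.\<close>

lemma row_row:
  assumes "l \<noteq> i" "l \<noteq> j" "m \<noteq> i" "m \<noteq> j"
  shows "\<delta> (E j l) (E j m) = 0"
proof (cases "l = m")
  case True
  have "\<delta> (E j l + 2 *\<^sub>M mat 1 - E j j - 3 *\<^sub>M E l l) (E j m) = 0"
    by (rule zero_at_zero[where T\<^sub>0 = "E i j - E i l" and r = 3])
      (use True assms i_neq_j in \<open>auto simp: compute\<close>)
  then show ?thesis using assms by (simp add: expand diag)
next
  case False
  have "\<delta> (E j l + mat 1 - E j j - E m m) (E j m) = 0"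
    by (rule zero_at_zero[where T\<^sub>0 = "2 *\<^sub>M E i j - E i l" and r = 2])
      (use False assms i_neq_j in \<open>auto simp: compute\<close>)
  then show ?thesis using assms by (simp add: expand diag)
qed

text \<open>Transposition followed by exchanging the indices i and j fixes e_ij and turns
  \<open>row_row\<close> into this lemma.\<close>

lemma column_column:
  assumes "k \<noteq> i" "k \<noteq> j" "m \<noteq> i" "m \<noteq> j"
  shows "\<delta> (E k i) (E m i) = 0"
proof (cases "k = m")
  case True
  have "\<delta> (E k i + 2 *\<^sub>M mat 1 - E i i - 3 *\<^sub>M E k k) (E m i) = 0"
    by (rule zero_at_zero[where T\<^sub>0 = "E i j - E k j" and r = 3])
      (use True assms i_neq_j in \<open>auto simp: compute\<close>)
  then show ?thesis using assms by (simp add: expand diag)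
next
  case False
  have "\<delta> (E k i + mat 1 - E i i - E m m) (E m i) = 0"
    by (rule zero_at_zero[where T\<^sub>0 = "2 *\<^sub>M E i j - E k j" and r = 2])
      (use False assms i_neq_j in \<open>auto simp: compute\<close>)
  then show ?thesis using assms by (simp add: expand diag)
qed

text \<open>For distinct k and l, e_jl o e_ki = 0. For k = l it is e_ji, and
  \<open>row_column\<close> treats that coupled pair.\<close>

lemma row_column_distinct:
  assumes "l \<noteq> i" "l \<noteq> j" "k \<noteq> i" "k \<noteq> j" "k \<noteq> l"
  shows "\<delta> (E j l) (E k i) = 0"
proof -
  have "\<delta> (E j l + mat 1 - E k k - E i i) (E k i) = 0"
    by (rule zero_at_zero[where T\<^sub>0 = "E i j - E i l" and r = 1])
      (use assms i_neq_j in \<open>auto simp: compute\<close>)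
  then show ?thesis using assms by (simp add: expand diag)
qed

lemma opposite_block:
  "\<delta> (E j i) (E i j) = 0" "\<delta> (E j i) (E j i) = 0" "\<delta> (E j i) (E i i) = 0" "\<delta> (E j i) (E j j) = 0"
proof -
  \<comment> \<open>For \<open>S = I + e\<^sub>j\<^sub>j + w e\<^sub>j\<^sub>i\<close>, \<open>S \<circ> T = 12 e\<^sub>i\<^sub>j\<close> is solved on the block of \<open>i\<close> and \<open>j\<close> by
    \<open>T = 4 e\<^sub>i\<^sub>j - 2 w e\<^sub>i\<^sub>i + w\<^sup>2 e\<^sub>j\<^sub>i - w e\<^sub>j\<^sub>j\<close>. The values \<open>w = 1, -1, 2\<close> separate the unknowns.\<close>
  define a where "a = \<delta> (E j i) (E i j)"
  define b where "b = \<delta> (E j i) (E j i)"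
  define c where "c = \<delta> (E j i) (E i i)"
  have T\<^sub>1: "\<delta> (mat 1 + E j j + E j i) (4 *\<^sub>M E i j - 2 *\<^sub>M E i i + E j i - E j j) = 0"
    by (rule zero_at_multiple[where r = 12]) (use i_neq_j in \<open>auto simp: compute\<close>)
  have T\<^sub>2: "\<delta> (mat 1 + E j j - E j i) (4 *\<^sub>M E i j + 2 *\<^sub>M E i i + E j i + E j j) = 0"
    by (rule zero_at_multiple[where r = 12]) (use i_neq_j in \<open>auto simp: compute\<close>)
  have T\<^sub>3: "\<delta> (mat 1 + E j j + 2 *\<^sub>M E j i)
      (4 *\<^sub>M E i j - 4 *\<^sub>M E i i + 4 *\<^sub>M E j i - 2 *\<^sub>M E j j) = 0"
    by (rule zero_at_multiple[where r = 12]) (use i_neq_j in \<open>auto simp: compute\<close>)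
  \<comment> \<open>For general w the relation is 4 w a - 2 w^2 c + w^3 b = 0; the two terms pairing
    e_jj with e_ji cancel by symmetry.\<close>
  have 1: "scale 4 a + b = scale 2 c"
    using T\<^sub>1 i_neq_j by (simp add: expand diag a_def b_def c_def commute[of "E j j" "E j i"] algebra_simps)
  have 2: "b + (scale 2 c + scale 4 a) = 0"
    using T\<^sub>2 i_neq_j by (simp add: expand diag a_def b_def c_def commute[of "E j j" "E j i"]
        neg_eq_iff_add_eq_0 algebra_simps)
  have 3: "scale 8 a + scale 8 b = scale 8 c"
    using T\<^sub>3 i_neq_j by (simp add: expand diag a_def b_def c_def commute[of "E j j" "E j i"] algebra_simps)
  have "scale 4 c = scale 2 c + scale 2 c" by (simp flip: scale_left_distrib)
  also have "\<dots> = 0" using 2 by (simp add: 1[symmetric] algebra_simps)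
  finally have c: "c = 0" by (simp add: scale_unit_eq_0_iff units)
  have b: "b = - scale 4 a" using 1 c by (simp add: eq_neg_iff_add_eq_0 add.commute)
  have "scale 24 a = 0" using 3 c b by (simp add: flip: scale_left_diff_distrib)
  moreover have "(24 :: 'r) dvd 1" using mult_dvd_mono[OF units(1,4)] by simp
  ultimately have a: "a = 0" by (simp add: scale_unit_eq_0_iff)
  then have b: "b = 0" using b by simp
  \<comment> \<open>Moving the eigenvalue 2 from j to i makes the terms with e_ii cancel instead and
    leaves the e_jj term with coefficient -2.\<close>
  have "\<delta> (mat 1 + E i i + E j i) (4 *\<^sub>M E i j - E i i + E j i - 2 *\<^sub>M E j j) = 0"
    by (rule zero_at_multiple[where r = 12]) (use i_neq_j in \<open>auto simp: compute\<close>)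
  then have "scale 2 (\<delta> (E j i) (E j j)) = 0"
    using i_neq_j a b c
    by (simp add: expand diag a_def b_def c_def commute[of "E i i" "E j i"])
  then show "\<delta> (E j i) (E j j) = 0" by (simp add: scale_unit_eq_0_iff units)
  show "\<delta> (E j i) (E i j) = 0" "\<delta> (E j i) (E j i) = 0" "\<delta> (E j i) (E i i) = 0"
    using a b c by (simp_all add: a_def b_def c_def)
qed

text \<open>The S of \<open>opposite_block\<close> with w = 1 has diagonal entries 1 at i and 2 at
  j. Changing its entry at an x outside {i, j} keeps its solution valid, and r adjusts that entry so
  that S o T = 0.\<close>

lemma opposite: "\<delta> (E j i) (E p q) = 0"
proof -
  have rule: "\<delta> (mat 1 + E j j + E j i - r *\<^sub>M E x x) T = 0"
    if "x \<noteq> i" "x \<noteq> j" "matrix_jordan (mat 1 + E j j + E j i - r *\<^sub>M E x x) T = 0" for r x T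
    by (rule zero_at_zero[where T\<^sub>0 = "4 *\<^sub>M E i j - 2 *\<^sub>M E i i + E j i - E j j" and r = 12])
      (use that i_neq_j in \<open>auto simp: jordan_expand units\<close>, auto simp: compute)
  have column: "\<delta> (E j i) (E k i) = 0" if "k \<noteq> i" "k \<noteq> j" for k
    using rule[of k 2 "E k i"] that i_neq_j by (simp add: compute expand diag)
  have row: "\<delta> (E j i) (E j k) = 0" if "k \<noteq> i" "k \<noteq> j" for k
    using rule[of k 3 "E j k"] that i_neq_j by (simp add: compute expand diag)
  consider "p \<noteq> i" "p \<noteq> j" "q \<noteq> i" "q \<noteq> j" | "p = i" "q \<noteq> i" "q \<noteq> j" | "p = j" "q \<noteq> i" "q \<noteq> j"
    | "p \<noteq> i" "p \<noteq> j" "q = i" | "p \<noteq> i" "p \<noteq> j" "q = j" | "p = i \<or> p = j" "q = i \<or> q = j" by blast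
  then show ?thesis
  proof cases
    case 1
    show ?thesis
      using rule[of q "if p = q then 1 else 2" "E p q"] 1 i_neq_j
      by (simp add: compute expand diag split: if_splits)
  next
    case 2
    show ?thesis
      using rule[of q 2 "E i q - E j q"] row[of q] 2 i_neq_j by (simp add: compute expand diag)
  next
    case 3
    then show ?thesis using row by blast
  next
    case 4
    then show ?thesis using column by blast
  next
    case 5
    show ?thesis
      using rule[of p 3 "E p j + E p i"] column[of p] 5 i_neq_j by (simp add: compute expand diag)
  next
    case 6
    then show ?thesis using opposite_block by auto
  qed
qed

lemma opposite': "\<delta> (E p q) (E j i) = 0"
  by (subst commute) (rule opposite)

text \<open>The excluded pair is e_jl with e_li, in either order. Settling all others first lets
  \<open>row_column\<close> isolate it in a single relation.\<close>

lemma units_vanish_unless: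
  assumes "\<not> (a = j \<and> b = c \<and> d = i \<and> b \<noteq> i \<and> b \<noteq> j)"
    and "\<not> (c = j \<and> d = a \<and> b = i \<and> d \<noteq> i \<and> d \<noteq> j)"
  shows "\<delta> (E a b) (E c d) = 0"
proof -
  consider "a = j \<and> b = i \<or> c = j \<and> d = i" | "a = b \<or> c = d" "a \<noteq> j \<or> b \<noteq> i" "c \<noteq> j \<or> d \<noteq> i"
    | "a \<noteq> b" "c \<noteq> d" "a \<noteq> j \<and> b \<noteq> i \<or> c \<noteq> j \<and> d \<noteq> i" "a \<noteq> j \<or> b \<noteq> i" "c \<noteq> j \<or> d \<noteq> i"
    | "a = j" "c = j" "a \<noteq> b" "c \<noteq> d" "b \<noteq> i" "d \<noteq> i"
    | "b = i" "d = i" "a \<noteq> b" "c \<noteq> d" "a \<noteq> j" "c \<noteq> j"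
    | "a = j" "d = i" "a \<noteq> b" "c \<noteq> d" "b \<noteq> i" "c \<noteq> j"
    | "c = j" "b = i" "a \<noteq> b" "c \<noteq> d" "a \<noteq> j" "d \<noteq> i" by blast
  then show ?thesis
  proof cases
    case 1
    then show ?thesis using opposite opposite' by blast
  next
    case 2
    then show ?thesis using diag diag' by blast
  next
    case 3
    then show ?thesis
      using off_diag_avoiding[of a b c d] off_diag_avoiding[of c d a b] commute[of "E a b" "E c d"]
      by auto
  next
    case 4
    then show ?thesis using row_row[of b d] by auto
  next
    case 5
    then show ?thesis using column_column[of a c] by auto
  next
    case 6
    then show ?thesis using row_column_distinct[of b c] assms by auto
  next
    case 7
    then show ?thesis using row_column_distinct[of d a] assms commute[of "E a b" "E c d"] by auto
  qed
qed

lemma row_column: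
  assumes "l \<noteq> i" "l \<noteq> j"
  shows "\<delta> (E j l) (E l i) = 0"
proof -
  \<comment> \<open>For idempotent \<open>P\<close>, \<open>(I + P) \<circ> T = 12 H\<close> is solved by \<open>T = 6 H - 2 (P H + H P) + P H P\<close>. Here
    \<open>P = (e\<^sub>j + e\<^sub>l) (e\<^sub>i + e\<^sub>l)\<^sup>T\<close>, so \<open>P H P = P\<close>.\<close>
  have "\<delta> (mat 1 + E j i + E j l + E l i + E l l)
      (6 *\<^sub>M E i j - 2 *\<^sub>M (E j j + E l j + E i i + E i l) + (E j i + E j l + E l i + E l l)) = 0"
    by (rule zero_at_multiple[where r = 12])
      (use assms i_neq_j in \<open>auto simp: jordan_expand mat.scale_right_distrib units\<close>, auto simp: compute)
  then have "\<delta> (E j l) (E l i) + \<delta> (E l i) (E j l) = 0"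
    using assms i_neq_j by (simp add: expand units_vanish_unless add.commute)
  then have "scale 2 (\<delta> (E j l) (E l i)) = 0"
    using scale_left_distrib[of 1 1 "\<delta> (E j l) (E l i)"] commute[of "E j l" "E l i"] by simp
  then show ?thesis by (simp add: scale_unit_eq_0_iff units)
qed

lemma units_vanish: "\<delta> (E a b) (E c d) = 0"
proof -
  consider "a = j \<and> b = c \<and> d = i \<and> b \<noteq> i \<and> b \<noteq> j" | "c = j \<and> d = a \<and> b = i \<and> d \<noteq> i \<and> d \<noteq> j"
    | "\<not> (a = j \<and> b = c \<and> d = i \<and> b \<noteq> i \<and> b \<noteq> j)" "\<not> (c = j \<and> d = a \<and> b = i \<and> d \<noteq> i \<and> d \<noteq> j)"
    by blast
  then show ?thesis
  proof cases
    case 1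
    then show ?thesis using row_column by blast
  next
    case 2
    then show ?thesis using row_column[of d] commute[of "E a b" "E c d"] by auto
  next
    case 3
    then show ?thesis by (rule units_vanish_unless)
  qed
qed

end

section \<open>From bimodule maps to defects\<close>

theorem corollary3p4:
  fixes i j :: "'n::finite"
  assumes "(6 :: 'r::comm_ring_1) dvd 1"
    and "CARD('n) \<ge> 3"
  shows "jordan_all_derivable_point TYPE('x::ab_group_add) (matrix_unit i j :: 'r^'n^'n)"
  unfolding jordan_all_derivable_point_def
proof (intro allI impI)
  fix scale :: "'r \<Rightarrow> 'x \<Rightarrow> 'x" and lact :: "'r^'n^'n \<Rightarrow> 'x \<Rightarrow> 'x" and ract and \<phi>
  assume bimodule: "matrix_bimodule scale lact ract"
    and hom: "module_hom smult_matrix scale \<phi>"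
    and one: "\<phi> (mat 1) = 0"
    and at: "jordan_derivable_at lact ract \<phi> (matrix_unit i j)"
  interpret matrix_bimodule scale lact ract by (fact bimodule)
  interpret \<phi>: module_hom smult_matrix scale \<phi> by (fact hom)
  define \<delta> where "\<delta> S T = \<phi> (matrix_jordan S T)
    - (bimodule_jordan lact ract (\<phi> S) T + bimodule_jordan lact ract (\<phi> T) S)" for S T
  have lact_scale: "lact (r *\<^sub>M S) x = scale r (lact S x)" for r S x
  proof -
    have "r *\<^sub>M S = mat r ** S"
      by (simp add: vec_eq_iff smult_matrix_def matrix_matrix_mult_def mat_def if_distrib
          if_distribR sum.delta cong: if_cong)
    then show ?thesis by (simp add: lact_mult lact_scalar)
  qed
  have ract_scale: "ract x (r *\<^sub>M S) = scale r (ract x S)" for r S x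
  proof -
    have "r *\<^sub>M S = S ** mat r"
      by (simp add: vec_eq_iff smult_matrix_def matrix_matrix_mult_def mat_def if_distrib
          if_distribR sum.delta mult.commute cong: if_cong)
    then show ?thesis by (simp add: ract_mult ract_scalar)
  qed
  \<comment> \<open>Written as the action of r I from the opposite side, r passes S because the two
    actions commute.\<close>
  have lact_scale_right: "lact S (scale r x) = scale r (lact S x)" for r S x
    by (metis lact_ract ract_scalar)
  have ract_scale_left: "ract (scale r x) S = scale r (ract x S)" for r S x
    by (metis lact_ract lact_scalar)
  have zero: "ract 0 S = 0" "lact S 0 = 0" for S
    using ract_add_left[of 0 0 S] lact_add_right[of S 0 0] by simp_all
  have defect: "jordan_defect scale \<delta> (matrix_unit i j)"
  proof
    show "(6 :: 'r) dvd 1" by (fact assms)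
  next
    fix S S' T
    show "\<delta> (S + S') T = \<delta> S T + \<delta> S' T"
      by (simp add: \<delta>_def bimodule_jordan_def jordan_expand \<phi>.add lact_add_left lact_add_right
          ract_add_left ract_add_right algebra_simps)
  next
    fix r S T
    show "\<delta> (r *\<^sub>M S) T = scale r (\<delta> S T)"
      by (simp add: \<delta>_def bimodule_jordan_def jordan_expand \<phi>.add \<phi>.scale lact_scale
          lact_scale_right ract_scale ract_scale_left scale_right_distrib scale_right_diff_distrib)
  next
    fix S T
    show "\<delta> S T = \<delta> T S"
      by (simp add: \<delta>_def matrix_jordan_def add.commute)
  next
    fix T
    \<comment> \<open>Both phi(I o T) and phi(T) o I equal 2 phi(T), and phi(I) = 0 removes the
      remaining term.\<close>
    show "\<delta> (mat 1) T = 0"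
      using \<phi>.add[of T T]
      by (simp add: \<delta>_def bimodule_jordan_def matrix_jordan_def one zero lact_one ract_one)
  next
    fix S T :: "'r^'n^'n"
    assume "matrix_jordan S T = matrix_unit i j"
    then show "\<delta> S T = 0"
      using at by (simp add: \<delta>_def jordan_derivable_at_def)
  qed
  have "\<delta> S T = 0" for S T
  proof (cases "i = j")
    case True
    then interpret diagonal_defect scale \<delta> i
      using defect by (simp add: diagonal_defect_def)
    show ?thesis using units_vanish by (rule vanishes)
  next
    case False
    then interpret off_diagonal_defect scale \<delta> i j
      using defect by (simp add: off_diagonal_defect_def off_diagonal_defect_axioms_def)
    show ?thesis using units_vanish by (rule vanishes)
  qed
  then show "jordan_derivation lact ract \<phi>"
    by (simp add: jordan_derivation_def \<delta>_def)
qed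

end
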